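(* Let $\Omega$ be an open convex set in $\mathbb{R}^n$, and let $f : \Omega \to \mathbb{R}$ be a function which is convex and specularly Fréchet differentiable in $\Omega$ (i.e. at every point of $\Omega$). Then, for each $\mathbf{x} \in \Omega$, the specular gradient satisfies $\blacktriangledown f(\mathbf{x}) \in \partial f(\mathbf{x})$, that is, $$f(\mathbf{w}) \geq \blacktriangledown f(\mathbf{x}) \cdot (\mathbf{w} - \mathbf{x}) + f(\mathbf{x}) \quad \text{for all } \mathbf{w} \in \Omega .$$
   Context: $\|\cdot\|$ is the Euclidean norm (on $\mathbb{R}^n$ or $\mathbb{R}^{n+1}$) and $\cdot$ is the dot product. Specular Fréchet differentiability: for $\Omega\subset\mathbb{R}^n$ open, $f:\Omega\to\mathbb{R}$ is specularly Fréchet differentiable at $\mathbf{x}\in\Omega$ if there exists a continuous linear $\ell:\mathbb{R}^n\to\mathbb{R}$ such that $$\lim_{\|\mathbf{w}\|\to 0}\left|\frac{f(\mathbf{x}+\mathbf{w})-f(\mathbf{x})-\ell(\mathbf{w})}{\|\mathbf{w}\|}\cdot\frac{\|J\|}{\|J\|+\|K\|}+\frac{f(\mathbf{x})-f(\mathbf{x}-\mathbf{w})-\ell(\mathbf{w})}{\|\mathbf{w}\|}\cdot\frac{\|K\|}{\|J\|+\|K\|}\right|=0,$$ where $J:=(\mathbf{w},f(\mathbf{x})-f(\mathbf{x}-\mathbf{w}))$ and $K:=(\mathbf{w},f(\mathbf{x}+\mathbf{w})-f(\mathbf{x}))$ in $\mathbb{R}^{n+1}$. Such an $\ell$ is unique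 if it exists; it is denoted $\widehat{D}f(\mathbf{x})$. The specular gradient $\blacktriangledown f(\mathbf{x})\in\mathbb{R}^n$ is the unique vector with $\widehat{D}f(\mathbf{x})(\mathbf{w})=\blacktriangledown f(\mathbf{x})\cdot\mathbf{w}$ for all $\mathbf{w}\in\mathbb{R}^n$. Subdifferential: $\partial f(\mathbf{x}):=\{\mathbf{s}\in\mathbb{R}^n: f(\mathbf{w})\ge f(\mathbf{x})+\mathbf{s}\cdot(\mathbf{w}-\mathbf{x})\text{ for all }\mathbf{w}\in\Omega\}$. *)

theory Defs
  imports "HOL-Analysis.Analysis"
begin

text \<open>
  A function on an open set \<open>\<Omega>\<close> is represented by a total function on the ambient space. The
  definition below is a limit at 0 with \<open>x\<close> interior to \<open>\<Omega>\<close>, so only the values of the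
  function on \<open>\<Omega>\<close> matter. The pairs \<open>J\<close> and \<open>K\<close> live in \<open>real ^ 'n \<times> real\<close>, whose library
  norm is the Euclidean norm of the (n+1)-dimensional space. The filter \<open>at 0\<close> excludes \<open>w = 0\<close>,
  so no denominator vanishes.
\<close>

definition has_specular_derivative ::
    "(real ^ 'n \<Rightarrow> real) \<Rightarrow> (real ^ 'n \<Rightarrow> real) \<Rightarrow> real ^ 'n \<Rightarrow> bool" where
  "has_specular_derivative f l x \<longleftrightarrow> bounded_linear l \<and>
     ((\<lambda>w. let J = (w, f x - f (x - w)); K = (w, f (x + w) - f x) in
        \<bar>(f (x + w) - f x - l w) / norm w * (norm J / (norm J + norm K))
         + (f x - f (x - w) - l w) / norm w * (norm K / (norm J + norm K))\<bar>)
      \<longlongrightarrow> 0) (at 0)"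

definition specularly_differentiable_at :: "(real ^ 'n \<Rightarrow> real) \<Rightarrow> real ^ 'n \<Rightarrow> bool" where
  "specularly_differentiable_at f x \<longleftrightarrow> (\<exists>l. has_specular_derivative f l x)"

definition specular_derivative :: "(real ^ 'n \<Rightarrow> real) \<Rightarrow> real ^ 'n \<Rightarrow> real ^ 'n \<Rightarrow> real" where
  "specular_derivative f x = (THE l. has_specular_derivative f l x)"

definition specular_gradient :: "(real ^ 'n \<Rightarrow> real) \<Rightarrow> real ^ 'n \<Rightarrow> real ^ 'n" where
  "specular_gradient f x = (THE v. \<forall>w. specular_derivative f x w = v \<bullet> w)"

definition subdifferential ::
    "(real ^ 'n) set \<Rightarrow> (real ^ 'n \<Rightarrow> real) \<Rightarrow> real ^ 'n \<Rightarrow> (real ^ 'n) set" where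
  "subdifferential \<Omega> f x = {s. \<forall>w\<in>\<Omega>. f w \<ge> f x + s \<bullet> (w - x)}"

text \<open>The two definite descriptions are well defined wherever the function is specularly
  differentiable.\<close>

lemma has_specular_derivative_unique:
  assumes "has_specular_derivative f l x" "has_specular_derivative f m x"
  shows "l = m"
proof -
  define D where "D = (\<lambda>k w. 
     (f (x + w) - f x - k w) / norm w *
       (norm (w, f x - f (x - w)) / (norm (w, f x - f (x - w)) + norm (w, f (x + w) - f x)))
     + (f x - f (x - w) - k w) / norm w *
       (norm (w, f (x + w) - f x) / (norm (w, f x - f (x - w)) + norm (w, f (x + w) - f x))))"
  have lin: "bounded_linear l" "bounded_linear m"
    using assms by (auto simp: has_specular_derivative_def)
  have "(D l \<longlongrightarrow> 0) (at 0)" "(D m \<longlongrightarrow> 0) (at 0)"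
    using assms by (simp_all add: has_specular_derivative_def D_def Let_def tendsto_rabs_zero_iff)
  then have lim: "((\<lambda>w. D m w - D l w) \<longlongrightarrow> 0) (at 0)"
    using tendsto_diff [of "D m" 0 "at 0" "D l" 0] by simp
  have alg: "(a - p) / c * (j / (j + k)) + (b - p) / c * (k / (j + k))
        - ((a - q) / c * (j / (j + k)) + (b - q) / c * (k / (j + k))) = (q - p) / c"
    if "j + k > 0" "c > 0" for a b c j k p q :: real
  proof -
    have "j / (j + k) + k / (j + k) = 1"
      using that by (simp add: add_divide_distrib [symmetric])
    moreover have "(a - p) / c * (j / (j + k)) + (b - p) / c * (k / (j + k))
        - ((a - q) / c * (j / (j + k)) + (b - q) / c * (k / (j + k)))
        = (q - p) / c * (j / (j + k) + k / (j + k))"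
      by (simp add: diff_divide_distrib algebra_simps)
    ultimately show ?thesis by simp
  qed
  have eq: "D m w - D l w = (l w - m w) / norm w" if "w \<noteq> 0" for w
  proof -
    have "norm (w, f x - f (x - w)) + norm (w, f (x + w) - f x) > 0"
      using that by (intro add_pos_pos) (auto simp: prod_eq_iff)
    from alg [OF this] show ?thesis
      unfolding D_def using that by simp
  qed
  have q: "((\<lambda>w. (l w - m w) / norm w) \<longlongrightarrow> 0) (at 0)"
    by (rule Lim_transform_eventually [OF lim]) (auto simp: eventually_at_filter eq)
  have "((\<lambda>w. l w - m w) has_derivative (\<lambda>w. 0)) (at 0)"
  proof -
    have z: "l 0 = 0" "m 0 = 0"
      using lin by (simp_all add: bounded_linear.linear linear_0)
    have "((\<lambda>w. \<bar>(l w - m w) / norm w\<bar>) \<longlongrightarrow> 0) (at 0)"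
      using q by (rule tendsto_rabs_zero)
    then show ?thesis
      by (simp add: has_derivative_at z)
  qed
  moreover have "((\<lambda>w. l w - m w) has_derivative (\<lambda>w. l w - m w)) (at 0)"
    using lin by (intro bounded_linear_imp_has_derivative bounded_linear_sub)
  ultimately have "(\<lambda>w. 0) = (\<lambda>w. l w - m w)"
    by (rule has_derivative_unique)
  then show ?thesis by (auto simp: fun_eq_iff)
qed

lemma has_specular_derivative_specular_derivative:
  assumes "specularly_differentiable_at f x"
  shows "has_specular_derivative f (specular_derivative f x) x"
proof -
  obtain l where l: "has_specular_derivative f l x"
    using assms by (auto simp: specularly_differentiable_at_def)
  show ?thesis
    unfolding specular_derivative_def
    by (rule theI [where a = l]) (use l has_specular_derivative_unique in blast)+
qed

lemma specular_gradient_inner: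
  assumes "specularly_differentiable_at f x"
  shows "specular_derivative f x w = specular_gradient f x \<bullet> w"
proof -
  let ?D = "specular_derivative f x"
  have "linear ?D"
    using has_specular_derivative_specular_derivative [OF assms]
    by (simp add: has_specular_derivative_def bounded_linear.linear)
  then have adj: "?D w = adjoint ?D 1 \<bullet> w" for w
    using adjoint_works [of ?D w 1] by (simp add: inner_commute)
  have "\<exists>!v. \<forall>w. ?D w = v \<bullet> w"
  proof (rule ex1I)
    show "\<forall>w. ?D w = adjoint ?D 1 \<bullet> w"
      using adj by blast
  next
    fix v assume "\<forall>w. ?D w = v \<bullet> w"
    then have "\<forall>w. v \<bullet> w = adjoint ?D 1 \<bullet> w"
      using adj by metis
    then show "v = adjoint ?D 1"
      by (simp only: vector_eq_rdot)
  qed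
  from theI' [OF this] show ?thesis
    unfolding specular_gradient_def by blast
qed

end

theory Submission
  imports Defs
begin

text \<open>
  For a convex function both one-sided difference quotients at \<open>x\<close> in the direction \<open>w - x\<close> are at
  most \<open>f w - f x\<close>. The expression in the specular limit is a weighted mean of these quotients
  minus the linear term, so it cannot tend to 0 unless the derivative in that direction is at
  most \<open>f w - f x\<close>.
\<close>

lemma weighted_mean_le:
  fixes a b c p q :: real
  assumes "a \<le> c" "b \<le> c" "p \<ge> 0" "q \<ge> 0" "p + q = 1"
  shows "a * p + b * q \<le> c"
proof -
  have "a * p + b * q \<le> c * p + c * q"
    using assms by (intro add_mono mult_right_mono) auto
  also have "\<dots> = c"
    using assms by (simp flip: distrib_left)
  finally show ?thesis .
qed

text \<open>Formulated for an arbitrary witness \<open>l\<close>, so definite descriptions stay out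
  of the limit argument; the theorem instantiates \<open>l\<close> with
  \<open>specular_derivative f x\<close>.\<close>

lemma has_specular_derivative_le:
  fixes f :: "real ^ 'n \<Rightarrow> real"
  assumes "open \<Omega>" "convex_on \<Omega> f" "x \<in> \<Omega>" "w \<in> \<Omega>"
    and l: "has_specular_derivative f l x"
  shows "l (w - x) \<le> f w - f x"
proof (cases "w = x")
  case True
  then show ?thesis
    using l by (simp add: has_specular_derivative_def bounded_linear.linear linear_0)
next
  case False
  define v where "v = w - x"
  have v: "v \<noteq> 0" "w = x + v"
    using False by (auto simp: v_def)
  have lin: "linear l"
    using l by (simp add: has_specular_derivative_def bounded_linear.linear)
  define J K where "J = (\<lambda>w. norm (w, f x - f (x - w)))" and "K = (\<lambda>w. norm (w, f (x + w) - f x))"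
  define D where "D = (\<lambda>w. (f (x + w) - f x - l w) / norm w * (J w / (J w + K w))
     + (f x - f (x - w) - l w) / norm w * (K w / (J w + K w)))"
  have "(D \<longlongrightarrow> 0) (at 0)"
    using l by (simp add: has_specular_derivative_def D_def J_def K_def Let_def tendsto_rabs_zero_iff)
  \<comment> \<open>The limit is restricted to the ray through \<open>v\<close>; since
    \<open>v\<close> is nonzero, the ray avoids 0 for \<open>t > 0\<close>.\<close>
  moreover have "filterlim (\<lambda>t. t *\<^sub>R v) (at 0) (at_right 0)"
    unfolding filterlim_at using v
    by (auto intro!: tendsto_eq_intros simp: eventually_at_filter)
  ultimately have lim: "((\<lambda>t. D (t *\<^sub>R v)) \<longlongrightarrow> 0) (at_right 0)"
    by (rule filterlim_compose)
  \<comment> \<open>The backward point may leave the segment from \<open>x\<close> to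
    \<open>w\<close>, so openness keeps it in \<open>\<Omega>\<close> for small \<open>t\<close>;
    the forward point lies on that segment.\<close>
  have "((\<lambda>t. x - t *\<^sub>R v) \<longlongrightarrow> x) (at_right 0)"
    by (auto intro!: tendsto_eq_intros)
  then have "\<forall>\<^sub>F t in at_right 0. x - t *\<^sub>R v \<in> \<Omega>"
    using assms(1,3) by (rule topological_tendstoD)
  moreover have "\<forall>\<^sub>F t in at_right 0. t \<in> {0<..<1::real}"
    by (rule eventually_at_right_real) simp
  ultimately have "\<forall>\<^sub>F t in at_right 0. D (t *\<^sub>R v) \<le> (f w - f x - l v) / norm v"
  proof eventually_elim
    case (elim t)
    let ?u = "t *\<^sub>R v"
    have t: "0 < t" "t < 1"
      using elim by auto
    have xu: "x + ?u = (1 - t) *\<^sub>R x + t *\<^sub>R w"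
      by (simp add: v algebra_simps)
    then have mem: "x + ?u \<in> \<Omega>"
      using t assms convex_on_imp_convex [OF assms(2)] by (auto intro: convexD)
    have fw: "f (x + ?u) - f x \<le> t * (f w - f x)"
      using convex_onD [OF assms(2), of t x w] t assms unfolding xu by argo
    \<comment> \<open>Midpoint convexity at \<open>x\<close> bounds the backward increment by the
      forward one.\<close>
    have "(1 - 1/2) *\<^sub>R (x + ?u) + (1/2) *\<^sub>R (x - ?u) = x"
      by (simp add: scaleR_add_right scaleR_diff_right flip: scaleR_left_distrib)
    then have bw: "f x - f (x - ?u) \<le> f (x + ?u) - f x"
      using convex_onD [OF assms(2), of "1/2" "x + ?u" "x - ?u"] mem elim by simp
    \<comment> \<open>By linearity of \<open>l\<close> the factor \<open>t\<close> cancels, leaving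
      a bound independent of \<open>t\<close> for both quotients.\<close>
    have quot: "(d - l ?u) / norm ?u \<le> (f w - f x - l v) / norm v" if "d \<le> t * (f w - f x)" for d
    proof -
      have "(d - l ?u) / norm ?u \<le> (t * (f w - f x - l v)) / norm ?u"
        using that by (intro divide_right_mono) (auto simp: linear_scale [OF lin] right_diff_distrib)
      also have "\<dots> = (f w - f x - l v) / norm v"
        using t by simp
      finally show ?thesis .
    qed
    have pos: "J ?u > 0" "K ?u > 0"
      using t v by (auto simp: J_def K_def prod_eq_iff)
    show ?case
      unfolding D_def
      by (rule weighted_mean_le) (use quot fw bw pos in \<open>auto simp flip: add_divide_distrib\<close>)
  qed
  \<comment> \<open>The constant bound survives the limit, which is 0.\<close>
  then have "0 \<le> (f w - f x - l v) / norm v"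
    using tendsto_upperbound [OF lim] by simp
  then show ?thesis
    using v by (simp add: zero_le_divide_iff flip: v_def)
qed

theorem theorem2p2:
  fixes \<Omega> :: "(real ^ 'n) set" and f :: "real ^ 'n \<Rightarrow> real"
  assumes "open \<Omega>" and "convex \<Omega>"
    and "convex_on \<Omega> f"
    and "\<forall>x\<in>\<Omega>. specularly_differentiable_at f x"
  shows "\<forall>x\<in>\<Omega>. specular_gradient f x \<in> subdifferential \<Omega> f x \<and>
           (\<forall>w\<in>\<Omega>. f w \<ge> specular_gradient f x \<bullet> (w - x) + f x)"
proof -
  have "specular_gradient f x \<bullet> (w - x) \<le> f w - f x" if "x \<in> \<Omega>" "w \<in> \<Omega>" for x w
  proof -
    have "specularly_differentiable_at f x"
      using assms(4) that by blast
    then show ?thesis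
      using has_specular_derivative_le [OF assms(1,3) that] specular_gradient_inner
        has_specular_derivative_specular_derivative by metis
  qed
  then show ?thesis
    by (fastforce simp: subdifferential_def)
qed

end
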